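(* Let $G$ be a finite simple graph with $m$ edges, with minimum vertex degree $\delta$, and let $\overline{m}=|E(\overline{G})|$. Then $$\overline{SO}(G)\leq \overline{M}_1(G)-(2-\sqrt{2})\,\delta\,\overline{m}.$$ Equality holds if $G$ is a regular graph.
   Context: All graphs are finite and simple, with nonempty vertex set. $d_G(u)$ denotes the degree of $u$ in $G$, and $\overline{G}$ is the complement of $G$; for $G$ on $n$ vertices and $m$ edges, $\overline{m}=|E(\overline{G})|=\binom{n}{2}-m$. The Sombor coindex and the first Zagreb coindex of $G$ are $$\overline{SO}(G)=\sum_{uv\in E(\overline{G})}\sqrt{d_G(u)^2+d_G(v)^2},\qquad \overline{M}_1(G)=\sum_{uv\in E(\overline{G})}[d_G(u)+d_G(v)],$$ the sums being over unordered pairs of distinct non-adjacent vertices of $G$, with degrees taken in $G$. *)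

theory Defs
  imports Complex_Main "HOL-Library.Ramsey"
begin

text \<open>A finite simple graph is given by its vertex set and its edge set, an edge being a
  two-element set of vertices (\<^const>\<open>nsets\<close> \<open>V 2\<close> is the set of all two-element
  subsets of \<open>V\<close>).\<close>

locale simple_graph =
  fixes V :: "'a set" and E :: "'a set set"
  assumes finite_verts: "finite V"
    and verts_nonempty: "V \<noteq> {}"
    and edges_subset: "E \<subseteq> nsets V 2"

definition degree :: "'a set set \<Rightarrow> 'a \<Rightarrow> nat" where
  "degree E v = card {e \<in> E. v \<in> e}"

definition min_degree :: "'a set \<Rightarrow> 'a set set \<Rightarrow> nat" where
  "min_degree V E = Min (degree E ` V)"

definition regular_graph :: "'a set \<Rightarrow> 'a set set \<Rightarrow> bool" where
  "regular_graph V E \<longleftrightarrow> (\<exists>k. \<forall>v\<in>V. degree E v = k)"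

definition complement_edges :: "'a set \<Rightarrow> 'a set set \<Rightarrow> 'a set set" where
  "complement_edges V E = nsets V 2 - E"

text \<open>In both coindices the inner sum over the two ends of the non-edge \<open>e = {u, v}\<close>
  makes the summand a function of the unordered pair; the degrees are those in the graph
  itself, not in its complement.\<close>

definition sombor_coindex :: "'a set \<Rightarrow> 'a set set \<Rightarrow> real" where
  "sombor_coindex V E =
     (\<Sum>e \<in> complement_edges V E. sqrt (\<Sum>u\<in>e. (real (degree E u))\<^sup>2))"

definition zagreb1_coindex :: "'a set \<Rightarrow> 'a set set \<Rightarrow> real" where
  "zagreb1_coindex V E = (\<Sum>e \<in> complement_edges V E. \<Sum>u\<in>e. real (degree E u))"

lemma sombor_summand:
  assumes "u \<noteq> v"
  shows "sqrt (\<Sum>w\<in>{u, v}. (real (degree E w))\<^sup>2)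
           = sqrt ((real (degree E u))\<^sup>2 + (real (degree E v))\<^sup>2)"
  using assms by simp

lemma zagreb1_summand:
  assumes "u \<noteq> v"
  shows "(\<Sum>w\<in>{u, v}. real (degree E w)) = real (degree E u) + real (degree E v)"
  using assms by simp

lemma (in simple_graph) card_complement_edges:
  "card (complement_edges V E) = (card V choose 2) - card E"
proof -
  have "finite (nsets V 2)"
    using finite_verts by (simp add: finite_imp_finite_nsets)
  then show ?thesis
    using edges_subset
    by (simp add: complement_edges_def card_Diff_subset finite_subset)
qed

end

theory Submission
  imports Defs
begin

text \<open>The bound holds summand by summand over the non-edges. For a non-edge whose ends have
  degrees \<open>a, b \<ge> \<delta>\<close>, write the vector \<open>(a, b)\<close> as \<open>(\<delta>, \<delta>) + (a - \<delta>, b - \<delta>)\<close>. The triangle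
  inequality in the Euclidean plane, together with the fact that the Euclidean norm of the
  nonnegative second vector is at most the sum of its coordinates, gives
  \<open>sqrt (a\<^sup>2 + b\<^sup>2) \<le> sqrt 2 * \<delta> + (a - \<delta>) + (b - \<delta>)\<close>
  (lemma \<open>sqrt_sum_squares_le_sum_minus_lower_bound\<close>). Each of the \<open>mbar\<close> non-edges thus
  saves \<open>(2 - sqrt 2) * \<delta>\<close>. In a regular graph the second vector vanishes for every non-edge,
  so nothing is lost.\<close>

lemma sqrt_sum_squares_eq_diagonal:
  fixes d :: real
  assumes "0 \<le> d"
  shows "sqrt (d\<^sup>2 + d\<^sup>2) = sqrt 2 * d"
proof -
  have "d\<^sup>2 + d\<^sup>2 = 2 * d\<^sup>2" by simp
  then show ?thesis using assms by (simp only: real_sqrt_mult real_sqrt_abs abs_of_nonneg)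
qed

text \<open>Splitting off the diagonal vector \<open>(d, d)\<close>, whose Euclidean norm falls short of its
  coordinate sum by exactly \<open>(2 - sqrt 2) * d\<close>; the remainder has nonnegative coordinates,
  so for it the coordinate sum is still an upper bound of the norm.\<close>

lemma sqrt_sum_squares_le_sum_minus_lower_bound:
  fixes a b d :: real
  assumes "0 \<le> d" "d \<le> a" "d \<le> b"
  shows "sqrt (a\<^sup>2 + b\<^sup>2) \<le> a + b - (2 - sqrt 2) * d"
proof -
  have "sqrt (a\<^sup>2 + b\<^sup>2) \<le> sqrt (d\<^sup>2 + d\<^sup>2) + sqrt ((a - d)\<^sup>2 + (b - d)\<^sup>2)"
    using real_sqrt_sum_squares_triangle_ineq[of d "a - d" d "b - d"] by simp
  also have "\<dots> \<le> sqrt 2 * d + ((a - d) + (b - d))"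
    using assms sqrt_sum_squares_le_sum[of "a - d" "b - d"] sqrt_sum_squares_eq_diagonal[of d]
    by linarith
  finally show ?thesis by (simp add: algebra_simps)
qed

context simple_graph
begin

lemma min_degree_le:
  assumes "v \<in> V"
  shows "min_degree V E \<le> degree E v"
  using assms finite_verts by (simp add: min_degree_def)

lemma regular_degree_eq_min_degree:
  assumes "regular_graph V E" "v \<in> V"
  shows "degree E v = min_degree V E"
proof -
  obtain k where k: "\<forall>v\<in>V. degree E v = k"
    using assms(1) by (auto simp: regular_graph_def)
  then have "degree E ` V = {k}" using verts_nonempty by auto
  then show ?thesis using k assms(2) by (simp add: min_degree_def)
qed

lemma complement_edgeE:
  assumes "e \<in> complement_edges V E"
  obtains u v where "e = {u, v}" "u \<noteq> v" "u \<in> V" "v \<in> V"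
proof -
  have "e \<in> nsets V 2" using assms by (simp add: complement_edges_def)
  then have "e \<subseteq> V" "card e = 2" by (auto simp: nsets_def)
  then show thesis using that by (auto simp: card_2_iff)
qed

end

theorem theorem3p5:
  fixes V :: "'a set" and E :: "'a set set" and m mbar \<delta> :: nat
  assumes "simple_graph V E"
    and "card E = m"
    and "min_degree V E = \<delta>"
    and "card (complement_edges V E) = mbar"
  shows "sombor_coindex V E \<le> zagreb1_coindex V E - (2 - sqrt 2) * real \<delta> * real mbar
    \<and> (regular_graph V E \<longrightarrow>
        sombor_coindex V E = zagreb1_coindex V E - (2 - sqrt 2) * real \<delta> * real mbar)"
proof -
  interpret simple_graph V E by fact
  let ?c = "(2 - sqrt 2) * real \<delta>"
  let ?sombor = "\<lambda>e. sqrt (\<Sum>u\<in>e. (real (degree E u))\<^sup>2)"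
  let ?zagreb = "\<lambda>e. \<Sum>u\<in>e. real (degree E u)"
  have total: "(\<Sum>e \<in> complement_edges V E. ?zagreb e - ?c)
      = zagreb1_coindex V E - ?c * real mbar"
    using assms(4) by (simp add: zagreb1_coindex_def sum_subtractf mult.commute)
  have "?sombor e \<le> ?zagreb e - ?c" if e: "e \<in> complement_edges V E" for e
  proof -
    obtain u v where uv: "e = {u, v}" "u \<noteq> v" "u \<in> V" "v \<in> V"
      using e by (rule complement_edgeE)
    have "real \<delta> \<le> real (degree E u)" "real \<delta> \<le> real (degree E v)"
      using uv min_degree_le assms(3) by auto
    then show ?thesis
      using uv sqrt_sum_squares_le_sum_minus_lower_bound[of "real \<delta>"] by simp
  qed
  then have le: "sombor_coindex V E \<le> zagreb1_coindex V E - ?c * real mbar"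
    unfolding total[symmetric] sombor_coindex_def by (rule sum_mono)
  have eq: "sombor_coindex V E = zagreb1_coindex V E - ?c * real mbar"
    if reg: "regular_graph V E"
  proof -
    have "?sombor e = ?zagreb e - ?c" if e: "e \<in> complement_edges V E" for e
    proof -
      obtain u v where uv: "e = {u, v}" "u \<noteq> v" "u \<in> V" "v \<in> V"
        using e by (rule complement_edgeE)
      have "degree E u = \<delta>" "degree E v = \<delta>"
        using uv regular_degree_eq_min_degree[OF reg] assms(3) by auto
      then have "?sombor e = sqrt 2 * real \<delta>" "?zagreb e = real \<delta> + real \<delta>"
        using uv sqrt_sum_squares_eq_diagonal[of "real \<delta>"] by simp_all
      then show ?thesis by (simp add: algebra_simps)
    qed
    then show ?thesis
      unfolding total[symmetric] sombor_coindex_def by (rule sum.cong[OF refl])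
  qed
  show ?thesis using le eq by blast
qed

end
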